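(* Let $0\le\gamma<1$, $q\in(0,1)$, $k\ge 0$, $\alpha>0$, $\beta>-1$. If $f(z)=z+\sum_{n=2}^\infty a_nz^n$ belongs to $k\text{-}\mathcal{JUST}(q;\alpha,\beta,\gamma)$, then for every integer $n\ge3$, $$|a_n|\le\frac{P_1}{([n]_q-1)\psi_n}\prod_{j=1}^{n-2}\Big(1+\frac{P_1}{[j+1]_q-1}\Big).$$
   Context: $\mathcal{A}$ is the class of functions $f(z)=z+\sum_{n\ge2}a_nz^n$ analytic in $\mathbb{D}=\{z\in\mathbb{C}:|z|<1\}$. For $q\in(0,1)$, $[x]_q=\frac{1-q^x}{1-q}$, and $\Gamma_q$ is the $q$-gamma function, satisfying $\Gamma_q(x+1)=[x]_q\Gamma_q(x)$; for $n\ge2$ $$\psi_n:=\frac{\Gamma_q(\beta+n)}{\Gamma_q(\alpha+\beta+n)}\frac{\Gamma_q(\alpha+\beta+1)}{\Gamma_q(\beta+1)}=\prod_{j=1}^{n-1}\frac{[\beta+j]_q}{[\alpha+\beta+j]_q}.$$ The $q$-derivative is $(D_qg)(z)=\frac{g(z)-g(qz)}{(1-q)z}$ for $z\ne0$ and $(D_qg)(0)=g'(0)$. The generalized $q$-integral operator is $\chi^{\alpha}_{\beta,q}f(z)=z+\sum_{n=2}^\infty\psi_na_nz^n$. A function $f\in\mathcal{A}$ is in $k\text{-}\mathcal{JUST}(q;\alpha,\beta,\gamma)$ if and only if, with $p(z)=\frac{zD_q(\chi^{\alpha}_{\beta,q}f)(z)}{\chi^{\alpha}_{\beta,q}f(z)}$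 (with $p(0)=1$; in particular $\chi^{\alpha}_{\beta,q}f(z)\neq0$ for $z\ne0$), one has $\operatorname{Re}p(z)>k|p(z)-1|+\gamma$ for all $z\in\mathbb{D}$. $P_1=p_{k,\gamma}'(0)$, where $p_{k,\gamma}$ is the conformal map of $\mathbb{D}$ onto $\Omega_{k,\gamma}=\{u+iv:u>k\sqrt{(u-1)^2+v^2}+\gamma\}$ with $p_{k,\gamma}(0)=1$, $p_{k,\gamma}'(0)>0$. Explicitly: $P_1=\frac{8(1-\gamma)(\arccos k)^2}{\pi^2(1-k^2)}$ for $0\le k<1$; $P_1=\frac{8(1-\gamma)}{\pi^2}$ for $k=1$; $P_1=\frac{\pi^2(1-\gamma)}{4\sqrt t(1+t)K^2(t)(k^2-1)}$ for $k>1$, where $K(t)=\int_0^1\frac{dx}{\sqrt{1-x^2}\sqrt{1-t^2x^2}}$, $K'(t)=K(\sqrt{1-t^2})$, and $t\in(0,1)$ is chosen with $k=\cosh\frac{\pi K'(t)}{4K(t)}$. *)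

theory Defs
  imports "HOL-Complex_Analysis.Complex_Analysis"
begin

section \<open>The class of normalised analytic functions\<close>

definition class_A :: "(complex \<Rightarrow> complex) set" where
  "class_A = {f. f holomorphic_on ball 0 1 \<and> f 0 = 0 \<and> deriv f 0 = 1}"

abbreviation taylor_coeff :: "(complex \<Rightarrow> complex) \<Rightarrow> nat \<Rightarrow> complex" where
  "taylor_coeff f n \<equiv> fps_nth (fps_expansion f 0) n"

lemma class_A_sums:
  assumes "f \<in> class_A" "z \<in> ball 0 1"
  shows "(\<lambda>n. taylor_coeff f (n + 2) * z ^ (n + 2)) sums (f z - z)"
proof -
  have "(\<lambda>n. (deriv ^^ n) f 0 / fact n * (z - 0) ^ n) sums f z"
    using assms by (intro holomorphic_power_series) (auto simp: class_A_def)
  hence "(\<lambda>n. taylor_coeff f n * z ^ n) sums f z"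
    by (simp add: fps_expansion_def)
  from sums_split_initial_segment[OF this, of 2] show ?thesis
    using assms by (simp add: class_A_def fps_expansion_def numeral_2_eq_2)
qed

section \<open>The \<open>q\<close>-gamma function and the \<open>q\<close>-integral operator\<close>

definition q_bracket :: "real \<Rightarrow> real \<Rightarrow> real" where
  "q_bracket q x = (1 - q powr x) / (1 - q)"

text \<open>
  Jackson's \<open>q\<close>-gamma function, for real \<open>0 < q < 1\<close> and \<open>x > 0\<close>, i.e.\
  \<open>(1 - q)\<^bsup>1 - x\<^esup> (q; q)\<^sub>\<infinity> / (q\<^sup>x; q)\<^sub>\<infinity>\<close>.
\<close>
definition q_Gamma :: "real \<Rightarrow> real \<Rightarrow> real" where
  "q_Gamma q x = (1 - q) powr (1 - x) *
     (\<Prod>n. 1 - q powr (real n + 1)) / (\<Prod>n. 1 - q powr (real n + x))"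

definition psi :: "real \<Rightarrow> real \<Rightarrow> real \<Rightarrow> nat \<Rightarrow> real" where
  "psi q \<alpha> \<beta> n =
     q_Gamma q (\<beta> + real n) / q_Gamma q (\<alpha> + \<beta> + real n) *
     (q_Gamma q (\<alpha> + \<beta> + 1) / q_Gamma q (\<beta> + 1))"

definition q_deriv :: "real \<Rightarrow> (complex \<Rightarrow> complex) \<Rightarrow> complex \<Rightarrow> complex" where
  "q_deriv q g z =
     (if z = 0 then deriv g 0 else (g z - g (of_real q * z)) / ((1 - of_real q) * z))"

definition chi :: "real \<Rightarrow> real \<Rightarrow> real \<Rightarrow> (complex \<Rightarrow> complex) \<Rightarrow> complex \<Rightarrow> complex" where
  "chi q \<alpha> \<beta> f z =
     z + (\<Sum>n. of_real (psi q \<alpha> \<beta> (n + 2)) * taylor_coeff f (n + 2) * z ^ (n + 2))"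

lemma q_powr_less_1:
  fixes q x :: real
  assumes "0 < q" "q < 1" "x > 0"
  shows "q powr x < 1"
  using powr_less_mono2[of x q 1] assms by simp

lemma convergent_prod_q:
  fixes q x :: real
  assumes "0 < q" "q < 1"
  shows "convergent_prod (\<lambda>n. 1 - q powr (real n + x))"
proof -
  have "summable (\<lambda>n. q powr x * q ^ n)"
    using assms by (intro summable_mult summable_geometric) auto
  also have "(\<lambda>n. q powr x * q ^ n) = (\<lambda>n. norm (1 - q powr (real n + x) - 1))"
    using assms by (auto simp: powr_add powr_realpow)
  finally show ?thesis
    by (intro abs_convergent_prod_imp_convergent_prod) (simp add: abs_convergent_prod_conv_summable)
qed

lemma q_prodinf_pos:
  fixes q x :: real
  assumes "0 < q" "q < 1" "x > 0"
  shows "(\<Prod>n. 1 - q powr (real n + x)) > 0"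
  using assms by (intro less_0_prodinf convergent_prod_q) (auto intro!: q_powr_less_1)

lemma q_Gamma_pos:
  assumes "0 < q" "q < 1" "x > 0"
  shows "q_Gamma q x > 0"
  unfolding q_Gamma_def
  using assms q_prodinf_pos[of q 1] q_prodinf_pos[of q x] by (auto intro!: divide_pos_pos mult_pos_pos)

lemma q_Gamma_1:
  assumes "0 < q" "q < 1"
  shows "q_Gamma q 1 = 1"
  using assms q_prodinf_pos[of q 1] by (simp add: q_Gamma_def)

lemma q_Gamma_plus1:
  assumes "0 < q" "q < 1" "x > 0"
  shows "q_Gamma q (x + 1) = q_bracket q x * q_Gamma q x"
proof -
  have nz: "1 - q powr x \<noteq> 0"
    using q_powr_less_1[OF assms] by simp
  have "(\<Prod>n. 1 - q powr (real (Suc n) + x)) = (\<Prod>n. 1 - q powr (real n + x)) / (1 - q powr x)"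
    using prodinf_split_head[OF convergent_prod_q[OF assms(1,2), of x]] nz by simp
  moreover have "(\<Prod>n. 1 - q powr (real (Suc n) + x)) = (\<Prod>n. 1 - q powr (real n + (x + 1)))"
    by (simp add: algebra_simps)
  ultimately have eq1: "(\<Prod>n. 1 - q powr (real n + (x + 1))) = (\<Prod>n. 1 - q powr (real n + x)) / (1 - q powr x)"
    by simp
  have eq2: "(1 - q) powr (1 - (x + 1)) = (1 - q) powr (1 - x) / (1 - q)"
    using assms by (simp add: powr_diff powr_minus field_simps)
  have "c / (1 - q) * A / (B / d) = d / (1 - q) * (c * A / B)" for c A B d :: real
    by simp
  thus ?thesis
    unfolding q_Gamma_def q_bracket_def eq1 eq2 .
qed

lemma psi_eq_prod:
  assumes "0 < q" "q < 1" "\<alpha> > 0" "\<beta> > -1" "n \<ge> 1"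
  shows "psi q \<alpha> \<beta> n =
    (\<Prod>j=1..n-1. q_bracket q (\<beta> + real j) / q_bracket q (\<alpha> + \<beta> + real j))"
  using \<open>n \<ge> 1\<close>
proof (induction n rule: nat_induct_at_least)
  case base
  show ?case
    using assms q_Gamma_pos[of q "\<beta> + 1"] q_Gamma_pos[of q "\<alpha> + \<beta> + 1"] by (simp add: psi_def)
next
  case (Suc n)
  have pos: "\<beta> + real n > 0" "\<alpha> + \<beta> + real n > 0"
    using assms Suc.hyps by auto
  have "psi q \<alpha> \<beta> (Suc n) =
          psi q \<alpha> \<beta> n * (q_bracket q (\<beta> + real n) / q_bracket q (\<alpha> + \<beta> + real n))"
    using q_Gamma_plus1[OF assms(1,2) pos(1)] q_Gamma_plus1[OF assms(1,2) pos(2)]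
    by (simp add: psi_def add_ac mult_ac)
  moreover have "{1..Suc n - 1} = insert n {1..n - 1}"
    using Suc.hyps by auto
  ultimately show ?case
    using Suc by simp
qed

section \<open>The class \<open>k\<close>-JUST\<close>

definition JUST_quot ::
    "real \<Rightarrow> real \<Rightarrow> real \<Rightarrow> (complex \<Rightarrow> complex) \<Rightarrow> complex \<Rightarrow> complex" where
  "JUST_quot q \<alpha> \<beta> f z =
     (if z = 0 then 1 else z * q_deriv q (chi q \<alpha> \<beta> f) z / chi q \<alpha> \<beta> f z)"

definition JUST ::
    "real \<Rightarrow> real \<Rightarrow> real \<Rightarrow> real \<Rightarrow> real \<Rightarrow> (complex \<Rightarrow> complex) set" where
  "JUST k q \<alpha> \<beta> \<gamma> = {f \<in> class_A.
     (\<forall>z \<in> ball 0 1 - {0}. chi q \<alpha> \<beta> f z \<noteq> 0) \<and>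
     (\<forall>z \<in> ball 0 1.
        Re (JUST_quot q \<alpha> \<beta> f z) > k * cmod (JUST_quot q \<alpha> \<beta> f z - 1) + \<gamma>)}"

section \<open>The conic domain, its conformal map, and \<open>P\<^sub>1\<close>\<close>

definition conic_domain :: "real \<Rightarrow> real \<Rightarrow> complex set" where
  "conic_domain k \<gamma> = {w. Re w > k * sqrt ((Re w - 1)\<^sup>2 + (Im w)\<^sup>2) + \<gamma>}"

definition normalised_conformal_map :: "complex set \<Rightarrow> (complex \<Rightarrow> complex) \<Rightarrow> bool" where
  "normalised_conformal_map \<Omega> p \<longleftrightarrow>
     p holomorphic_on ball 0 1 \<and> inj_on p (ball 0 1) \<and> p ` ball 0 1 = \<Omega> \<and>
     p 0 = 1 \<and> (\<exists>c>0. deriv p 0 = complex_of_real c)"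

text \<open>
  The choice is determined on the unit disc; see \<open>p_conic_conformal\<close> and
  \<open>normalised_conformal_map_unique\<close> below.
\<close>
definition p_conic :: "real \<Rightarrow> real \<Rightarrow> complex \<Rightarrow> complex" where
  "p_conic k \<gamma> = (SOME p. normalised_conformal_map (conic_domain k \<gamma>) p)"

text \<open>The derivative at 0 is a positive real by normalisation, so \<open>Re\<close> is only a coercion.\<close>
definition P1 :: "real \<Rightarrow> real \<Rightarrow> real" where
  "P1 k \<gamma> = Re (deriv (p_conic k \<gamma>) 0)"

lemma conic_domain_altdef: "conic_domain k \<gamma> = {w. Re w > k * cmod (w - 1) + \<gamma>}"
  by (simp add: conic_domain_def cmod_def)

lemma open_conic_domain: "open (conic_domain k \<gamma>)"
  unfolding conic_domain_altdef by (intro open_Collect_less continuous_intros)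

lemma convex_conic_domain:
  assumes "k \<ge> 0"
  shows "convex (conic_domain k \<gamma>)"
proof (rule convexI)
  fix x y :: complex and u v :: real
  assume xy: "x \<in> conic_domain k \<gamma>" "y \<in> conic_domain k \<gamma>" and uv: "0 \<le> u" "0 \<le> v" "u + v = 1"
  have eq: "u *\<^sub>R x + v *\<^sub>R y - 1 = u *\<^sub>R (x - 1) + v *\<^sub>R (y - 1)"
    using uv(3) by (simp add: algebra_simps flip: scaleR_add_left)
  have "cmod (u *\<^sub>R x + v *\<^sub>R y - 1) \<le> u * cmod (x - 1) + v * cmod (y - 1)"
    unfolding eq using uv norm_triangle_ineq[of "u *\<^sub>R (x - 1)" "v *\<^sub>R (y - 1)"] by simp
  hence "k * cmod (u *\<^sub>R x + v *\<^sub>R y - 1) + \<gamma> \<le> k * (u * cmod (x - 1) + v * cmod (y - 1)) + \<gamma>"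
    using assms by (simp add: mult_left_mono)
  also have "\<dots> = u * (k * cmod (x - 1) + \<gamma>) + v * (k * cmod (y - 1) + \<gamma>)"
  proof -
    have "\<gamma> = (u + v) * \<gamma>" using uv by simp
    thus ?thesis by (simp add: algebra_simps)
  qed
  also have "\<dots> < u * Re x + v * Re y"
  proof (cases "u = 0")
    case True
    thus ?thesis using xy uv by (simp add: conic_domain_altdef)
  next
    case False
    hence "u * (k * cmod (x - 1) + \<gamma>) < u * Re x"
      using xy uv by (intro mult_strict_left_mono) (auto simp: conic_domain_altdef)
    moreover have "v * (k * cmod (y - 1) + \<gamma>) \<le> v * Re y"
      using xy uv by (intro mult_left_mono) (auto simp: conic_domain_altdef)
    ultimately show ?thesis by linarith
  qed
  finally show "u *\<^sub>R x + v *\<^sub>R y \<in> conic_domain k \<gamma>"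
    by (simp add: conic_domain_altdef)
qed

lemma normalised_conformal_map_exists:
  assumes "open \<Omega>" "simply_connected \<Omega>" "1 \<in> \<Omega>" "\<Omega> \<noteq> UNIV"
  shows "\<exists>p. normalised_conformal_map \<Omega> p"
proof -
  obtain f g where f: "f holomorphic_on \<Omega>" and g: "g holomorphic_on ball 0 1"
    and fg: "\<And>z. z \<in> \<Omega> \<Longrightarrow> f z \<in> ball 0 1 \<and> g (f z) = z"
            "\<And>z. z \<in> ball 0 1 \<Longrightarrow> g z \<in> \<Omega> \<and> f (g z) = z"
    using Riemann_mapping_theorem[of \<Omega>] assms by blast
  define a where "a = f 1"
  have a: "norm a < 1"
    using fg(1)[OF assms(3)] by (simp add: a_def)
  define M where "M = Moebius_function 0 (-a)"
  define N where "N = Moebius_function 0 a"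
  have M: "M holomorphic_on ball 0 1" "M ` ball 0 1 \<subseteq> ball 0 1" "M 0 = a"
    using a by (auto simp: M_def Moebius_function_of_zero intro!: Moebius_function_holomorphic Moebius_function_norm_lt_1)
  have N: "N ` ball 0 1 \<subseteq> ball 0 1"
    using a by (auto simp: N_def intro!: Moebius_function_norm_lt_1)
  have MN: "M (N z) = z" "N (M z) = z" if "norm z < 1" for z
    using a that by (auto simp: M_def N_def intro!: Moebius_function_compose)
  define h where "h = g \<circ> M"
  have h: "h holomorphic_on ball 0 1"
    unfolding h_def using holomorphic_on_compose_gen[OF M(1) g M(2)] .
  have injh: "inj_on h (ball 0 1)"
  proof (rule inj_on_inverseI[where g = "N \<circ> f"])
    fix z :: complex assume "z \<in> ball 0 1"
    thus "(N \<circ> f) (h z) = z"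
      using fg(2)[of "M z"] M(2) MN(2)[of z] by (force simp: h_def image_subset_iff)
  qed
  have imh: "h ` ball 0 1 = \<Omega>"
  proof (intro equalityI subsetI)
    fix w assume "w \<in> h ` ball 0 1"
    thus "w \<in> \<Omega>" using fg(2) M(2) by (auto simp: h_def)
  next
    fix w assume w: "w \<in> \<Omega>"
    hence "N (f w) \<in> ball 0 1" "h (N (f w)) = w"
      using fg(1)[OF w] N MN(1)[of "f w"] by (auto simp: h_def image_subset_iff)
    thus "w \<in> h ` ball 0 1" by force
  qed
  have h0: "h 0 = 1"
    using fg(1)[OF assms(3)] M(3) by (simp add: h_def a_def)
  define d where "d = deriv h 0"
  have d: "d \<noteq> 0"
    unfolding d_def using holomorphic_injective_imp_regular[OF h _ injh, of 0] by simp
  define c where "c = cnj (sgn d)"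
  have c: "norm c = 1"
    using d by (simp add: c_def norm_sgn)
  have cd: "d * c = of_real (norm d)"
  proof -
    have "d * cnj d = of_real (norm d) * of_real (norm d)"
      using complex_norm_square[of d] by (simp add: power2_eq_square)
    thus ?thesis
      using d by (simp add: c_def sgn_eq field_simps)
  qed
  define p where "p = (\<lambda>z. h (c * z))"
  have im: "(\<lambda>z. c * z) ` ball 0 1 = ball 0 1"
  proof (intro equalityI subsetI)
    fix w :: complex assume "w \<in> ball 0 1"
    thus "w \<in> (\<lambda>z. c * z) ` ball 0 1"
      using c by (intro image_eqI[of _ _ "w / c"]) (auto simp: norm_divide)
  qed (use c in \<open>auto simp: norm_mult\<close>)
  have "p holomorphic_on ball 0 1"
    using holomorphic_on_compose_gen[of "\<lambda>z. c * z" "ball 0 1" h "ball 0 1"] h im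
    by (auto simp: p_def o_def intro!: holomorphic_intros)
  moreover have "inj_on p (ball 0 1)"
  proof -
    have "inj_on (h \<circ> (\<lambda>z. c * z)) (ball 0 1)"
      using c injh by (intro comp_inj_on) (auto simp: im inj_on_def)
    thus ?thesis by (simp add: p_def o_def)
  qed
  moreover have "p ` ball 0 1 = \<Omega>"
    using im imh unfolding p_def by (metis image_image)
  moreover have "p 0 = 1"
    by (simp add: p_def h0)
  moreover have "deriv p 0 = of_real (norm d)"
  proof -
    have "(h has_field_derivative d) (at (c * 0))"
      unfolding d_def using holomorphic_derivI[OF h, of 0] by simp
    hence "(p has_field_derivative d * c) (at 0)"
      unfolding p_def by (rule DERIV_chain2) (auto intro!: derivative_eq_intros)
    thus ?thesis using cd DERIV_imp_deriv by metis
  qed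
  ultimately show ?thesis
    using d unfolding normalised_conformal_map_def by (intro exI[of _ p] conjI exI[of _ "norm d"]) auto
qed

lemma normalised_conformal_map_unique:
  assumes p1: "normalised_conformal_map \<Omega> p1" and p2: "normalised_conformal_map \<Omega> p2"
    and z: "z \<in> ball 0 1"
  shows "p1 z = p2 z"
proof -
  have *: "\<exists>\<phi>. \<phi> holomorphic_on ball 0 1 \<and> \<phi> ` ball 0 1 \<subseteq> ball 0 1 \<and> \<phi> 0 = 0 \<and>
      (\<forall>z\<in>ball 0 1. q (\<phi> z) = p z \<and> norm (\<phi> z) \<le> norm z)"
    if p: "normalised_conformal_map \<Omega> p" and q: "normalised_conformal_map \<Omega> q" for p q
  proof -
    have hol: "q holomorphic_on ball 0 1" "inj_on q (ball 0 1)" "p holomorphic_on ball 0 1"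
      and im: "q ` ball 0 1 = \<Omega>" "p ` ball 0 1 = \<Omega>" and 0: "p 0 = 1" "q 0 = 1"
      using p q by (auto simp: normalised_conformal_map_def)
    obtain r where r: "r holomorphic_on \<Omega>" "\<And>z. z \<in> ball 0 1 \<Longrightarrow> r (q z) = z"
      using holomorphic_has_inverse[OF hol(1) open_ball hol(2)] im(1) by metis
    define \<phi> where "\<phi> = r \<circ> p"
    have a: "\<phi> holomorphic_on ball 0 1"
      unfolding \<phi>_def using holomorphic_on_compose_gen[OF hol(3) r(1)] im by auto
    have b: "\<phi> z \<in> ball 0 1 \<and> q (\<phi> z) = p z" if z: "z \<in> ball 0 1" for z
    proof -
      obtain y where "y \<in> ball 0 1" "p z = q y" using im z by (metis imageE imageI)
      thus ?thesis using r(2)[of y] by (simp add: \<phi>_def)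
    qed
    have c: "\<phi> 0 = 0"
      using r(2)[of 0] 0 by (simp add: \<phi>_def)
    have "norm (\<phi> z) \<le> norm z" if "z \<in> ball 0 1" for z
      using Schwarz_Lemma(1)[OF a c] b that by auto
    with a b c show ?thesis by (intro exI[of _ \<phi>]) auto
  qed
  obtain \<phi> where \<phi>: "\<phi> holomorphic_on ball 0 1" "\<phi> ` ball 0 1 \<subseteq> ball 0 1" "\<phi> 0 = 0"
      "\<And>z. z \<in> ball 0 1 \<Longrightarrow> p2 (\<phi> z) = p1 z" "\<And>z. z \<in> ball 0 1 \<Longrightarrow> norm (\<phi> z) \<le> norm z"
    using *[OF p1 p2] by blast
  obtain \<theta> where \<theta>: "\<theta> ` ball 0 1 \<subseteq> ball 0 1"
      "\<And>z. z \<in> ball 0 1 \<Longrightarrow> p1 (\<theta> z) = p2 z" "\<And>z. z \<in> ball 0 1 \<Longrightarrow> norm (\<theta> z) \<le> norm z"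
    using *[OF p2 p1] by blast
  have inj: "inj_on p1 (ball 0 1)" and hol: "p2 holomorphic_on ball 0 1"
    using p1 p2 by (auto simp: normalised_conformal_map_def)
  have inv: "\<theta> (\<phi> z) = z" if z: "z \<in> ball 0 1" for z
  proof -
    have "\<phi> z \<in> ball 0 1" using \<phi>(2) z by blast
    hence "\<theta> (\<phi> z) \<in> ball 0 1" "p1 (\<theta> (\<phi> z)) = p1 z"
      using \<theta>(1) \<theta>(2)[of "\<phi> z"] \<phi>(4)[OF z] by (blast, simp)
    thus ?thesis using inj z by (auto dest: inj_onD)
  qed
  have half: "(1/2::complex) \<in> ball 0 1" by (simp add: norm_divide)
  have "\<phi> (1/2) \<in> ball 0 1" using \<phi>(2) half by blast
  hence "norm (\<phi> (1/2)) = norm (1/2::complex)"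
    using \<phi>(5)[OF half] \<theta>(3)[of "\<phi> (1/2)"] unfolding inv[OF half] by linarith
  hence ex: "\<exists>z. norm z < 1 \<and> z \<noteq> 0 \<and> norm (\<phi> z) = norm z"
    using half by (intro exI[of _ "1/2"]) auto
  have lt: "norm (\<phi> z) < 1" if "norm z < 1" for z
    using \<phi>(2) that by fastforce
  have "\<exists>\<alpha>. (\<forall>z. norm z < 1 \<longrightarrow> \<phi> z = \<alpha> * z) \<and> norm \<alpha> = 1"
    by (rule Schwarz_Lemma(3)[OF \<phi>(1,3) lt, of 0]) (use ex in auto)
  then obtain \<alpha> where \<alpha>: "\<And>z. norm z < 1 \<Longrightarrow> \<phi> z = \<alpha> * z" "norm \<alpha> = 1"
    by blast
  have p1_eq: "p1 z = p2 (\<alpha> * z)" if "z \<in> ball 0 1" for z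
    using \<phi>(4)[OF that] \<alpha>(1)[of z] that by simp
  have "(p2 has_field_derivative deriv p2 0) (at (\<alpha> * 0))"
    using holomorphic_derivI[OF hol, of 0] by simp
  hence "((\<lambda>z. p2 (\<alpha> * z)) has_field_derivative deriv p2 0 * \<alpha>) (at 0)"
    by (rule DERIV_chain2) (auto intro!: derivative_eq_intros)
  hence "(p1 has_field_derivative deriv p2 0 * \<alpha>) (at 0)"
    by (rule has_field_derivative_transform_within_open[where S = "ball 0 1"]) (auto simp: p1_eq)
  hence d: "deriv p1 0 = deriv p2 0 * \<alpha>"
    by (rule DERIV_imp_deriv)
  obtain c1 c2 where c: "c1 > 0" "c2 > 0" "deriv p1 0 = complex_of_real c1" "deriv p2 0 = complex_of_real c2"
    using p1 p2 by (auto simp: normalised_conformal_map_def)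
  have "norm (deriv p1 0) = norm (deriv p2 0)"
    using \<alpha>(2) by (simp add: d norm_mult)
  hence "c1 = c2" using c by simp
  hence "\<alpha> = 1" using d c by simp
  thus ?thesis using p1_eq[OF z] by simp
qed

lemma p_conic_conformal:
  assumes "0 \<le> \<gamma>" "\<gamma> < 1" "k \<ge> 0"
  shows "normalised_conformal_map (conic_domain k \<gamma>) (p_conic k \<gamma>)"
proof -
  have "0 \<notin> conic_domain k \<gamma>" "1 \<in> conic_domain k \<gamma>"
    using assms by (auto simp: conic_domain_altdef)
  hence "\<exists>p. normalised_conformal_map (conic_domain k \<gamma>) p"
    using assms
    by (intro normalised_conformal_map_exists open_conic_domain
          convex_imp_simply_connected convex_conic_domain) auto
  thus ?thesis
    unfolding p_conic_def by (rule someI_ex)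
qed

lemma P1_pos_and_deriv:
  assumes "0 \<le> \<gamma>" "\<gamma> < 1" "k \<ge> 0"
  shows "P1 k \<gamma> > 0" and "deriv (p_conic k \<gamma>) 0 = complex_of_real (P1 k \<gamma>)"
  using p_conic_conformal[OF assms] by (auto simp: normalised_conformal_map_def P1_def)

end

theory Submission
  imports Defs
begin

text \<open>
  Let \<open>g\<close> be the image of \<open>f\<close> under the \<open>q\<close>-integral operator, with coefficients
  \<open>b\<^sub>n = \<psi>\<^sub>n a\<^sub>n\<close>, and let \<open>p = z D\<^sub>q g / g = 1 + c\<^sub>1 z + c\<^sub>2 z\<^sup>2 + \<dots>\<close>. Membership of \<open>f\<close> in the
  class says that \<open>p\<close> maps the disc into the conic domain. This domain is convex (for every
  \<open>k \<ge> 0\<close>) and is the image of the conformal map with derivative \<open>P\<^sub>1\<close> at 0, so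
  Rogosinski's theorem (\<open>convex_subordination_coeff_bound\<close>) bounds every \<open>c\<^sub>i\<close> with \<open>i \<ge> 1\<close>
  by \<open>P\<^sub>1\<close>.

  Since \<open>D\<^sub>q\<close> multiplies the \<open>n\<close>-th coefficient by \<open>[n]\<^sub>q\<close>, comparing coefficients in
  \<open>z D\<^sub>q g = p g\<close> (\<open>JUST_quot_holomorphic_recurrence\<close>) gives
  \<open>([n]\<^sub>q - 1) b\<^sub>n = c\<^sub>1 b\<^bsub>n-1\<^esub> + \<dots> + c\<^bsub>n-1\<^esub> b\<^sub>1\<close>. With the bound on the \<open>c\<^sub>i\<close>, induction
  (\<open>convolution_recurrence_bound\<close>) turns this into a product bound for \<open>\<bar>b\<^sub>n\<bar>\<close>, and division
  by \<open>\<psi>\<^sub>n > 0\<close> gives the bound for \<open>\<bar>a\<^sub>n\<bar>\<close>. The recurrence is stated for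
  \<open>u m = b\<^bsub>m+1\<^esub>\<close>, because \<open>g / z\<close> rather than \<open>g\<close> is the zero-free factor.
\<close>

section \<open>Power series on the unit disc\<close>

lemma power_series_on_unit_disc:
  fixes f :: "complex \<Rightarrow> complex"
  assumes "\<And>z. norm z < 1 \<Longrightarrow> (\<lambda>n. a n * z ^ n) sums f z"
  shows power_series_on_unit_disc_holomorphic: "f holomorphic_on ball 0 1"
    and power_series_on_unit_disc_coeff: "taylor_coeff f n = a n"
proof -
  show "f holomorphic_on ball 0 1"
    by (rule power_series_holomorphic[where a = a]) (use assms in auto)
  have "eventually (\<lambda>z::complex. z \<in> ball 0 1) (nhds 0)"
    by (intro eventually_nhds_in_open) auto
  hence "f has_fps_expansion Abs_fps a"
    by (intro has_fps_expansionI) (auto elim!: eventually_mono intro: assms)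
  thus "taylor_coeff f n = a n"
    by (simp add: fps_expansion_eqI)
qed

lemma holomorphic_imp_taylor_sums:
  assumes "f holomorphic_on ball 0 1" "norm z < 1"
  shows "(\<lambda>n. taylor_coeff f n * z ^ n) sums f z"
  using holomorphic_power_series[OF assms(1), of z] assms(2)
  by (simp add: fps_expansion_def)

section \<open>Coefficients of functions subordinate to a convex map\<close>

text \<open>
  Schwarz's lemma, applied to the holomorphic self-map of the disc that carries one function
  through the univalent other one.
\<close>
lemma subordinate_deriv_le:
  assumes P: "P holomorphic_on ball 0 1" "inj_on P (ball 0 1)"
    and h: "h holomorphic_on ball 0 1" "h ` ball 0 1 \<subseteq> P ` ball 0 1" "h 0 = P 0"
  shows "norm (deriv h 0) \<le> norm (deriv P 0)"
proof -
  obtain r where r: "r holomorphic_on P ` ball 0 1" "\<And>z. z \<in> ball 0 1 \<Longrightarrow> r (P z) = z"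
    using holomorphic_has_inverse[OF P(1) open_ball P(2)] by metis
  define \<phi> where "\<phi> = r \<circ> h"
  have hol: "\<phi> holomorphic_on ball 0 1"
    unfolding \<phi>_def using holomorphic_on_compose_gen[OF h(1) r(1) h(2)] .
  have \<phi>: "\<phi> z \<in> ball 0 1 \<and> P (\<phi> z) = h z" if z: "z \<in> ball 0 1" for z
  proof -
    obtain y where "y \<in> ball 0 1" "h z = P y"
      using h(2) z by blast
    thus ?thesis using r(2)[of y] by (simp add: \<phi>_def)
  qed
  have \<phi>0: "\<phi> 0 = 0"
    using r(2)[of 0] h(3) by (simp add: \<phi>_def)
  have "norm (deriv \<phi> 0) \<le> 1"
    by (rule Schwarz_Lemma(2)[OF hol \<phi>0, of 0]) (use \<phi> in auto)
  moreover have "deriv h 0 = deriv P 0 * deriv \<phi> 0"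
  proof -
    have "(P has_field_derivative deriv P 0) (at (\<phi> 0))"
      using holomorphic_derivI[OF P(1), of 0] by (simp add: \<phi>0)
    moreover have "(\<phi> has_field_derivative deriv \<phi> 0) (at 0)"
      using holomorphic_derivI[OF hol, of 0] by simp
    ultimately have "((\<lambda>z. P (\<phi> z)) has_field_derivative deriv P 0 * deriv \<phi> 0) (at 0)"
      by (rule DERIV_chain2)
    hence "(h has_field_derivative deriv P 0 * deriv \<phi> 0) (at 0)"
      by (rule has_field_derivative_transform_within_open[where S = "ball 0 1"]) (use \<phi> in auto)
    thus ?thesis by (rule DERIV_imp_deriv)
  qed
  ultimately show ?thesis
    by (simp add: norm_mult mult_left_le)
qed

lemma sum_root_of_unity_powers:
  fixes n m :: nat
  assumes "n \<ge> 1"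
  defines "\<omega> \<equiv> exp (2 * of_real pi * \<i> / of_nat n)"
  shows "(\<Sum>j<n. (\<omega> ^ j) ^ m) = (if n dvd m then of_nat n else 0)"
proof -
  have m: "\<omega> ^ m = exp (2 * of_real pi * \<i> * of_nat m / of_nat n)" for m
    by (simp add: \<omega>_def mult_ac flip: exp_of_nat_mult)
  have "(\<Sum>j<n. (\<omega> ^ j) ^ m) = (\<Sum>j<n. (\<omega> ^ m) ^ j)"
    by (simp add: mult.commute flip: power_mult)
  also have "\<dots> = (if n dvd m then of_nat n else 0)"
  proof (cases "n dvd m")
    case True
    hence "\<omega> ^ m = 1"
      using complex_root_unity_eq_1[OF assms(1), of m] by (simp add: m)
    thus ?thesis using True by simp
  next
    case False
    hence "\<omega> ^ m \<noteq> 1"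
      using complex_root_unity_eq_1[OF assms(1), of m] by (simp add: m)
    moreover have "(\<omega> ^ m) ^ n = 1"
      using complex_root_unity[of n m] assms(1) by (simp add: m)
    ultimately show ?thesis using False by (simp add: geometric_sum)
  qed
  finally show ?thesis .
qed

text \<open>
  Rogosinski's coefficient bound. Averaging \<open>p\<close> over the rotations by \<open>n\<close>-th roots of unity
  keeps exactly the coefficients whose index is a multiple of \<open>n\<close>, so the average is
  \<open>h (z\<^sup>n)\<close> with \<open>h'(0)\<close> the \<open>n\<close>-th coefficient of \<open>p\<close>; by convexity the average, and hence
  \<open>h\<close>, still maps into the image of \<open>P\<close>.
\<close>
lemma convex_subordination_coeff_bound:
  assumes P: "P holomorphic_on ball 0 1" "inj_on P (ball 0 1)" "convex (P ` ball 0 1)"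
    and p: "p holomorphic_on ball 0 1" "p ` ball 0 1 \<subseteq> P ` ball 0 1" "p 0 = P 0"
    and n: "n \<ge> 1"
  shows "norm (taylor_coeff p n) \<le> norm (deriv P 0)"
proof -
  define \<omega> where "\<omega> = exp (2 * of_real pi * \<i> / of_nat n)"
  define c where "c = taylor_coeff p"
  define h where "h = (\<lambda>w. \<Sum>m. c (n * m) * w ^ m)"
  have norm\<omega>: "norm \<omega> = 1"
    by (simp add: \<omega>_def)
  have avg: "(\<lambda>m. c (n * m) * (z ^ n) ^ m) sums (\<Sum>j<n. (1 / real n) *\<^sub>R p (\<omega> ^ j * z))"
    if z: "norm z < 1" for z
  proof -
    have "(\<lambda>m. \<Sum>j<n. (1 / real n) *\<^sub>R (c m * (\<omega> ^ j * z) ^ m)) sums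
            (\<Sum>j<n. (1 / real n) *\<^sub>R p (\<omega> ^ j * z))"
      unfolding c_def using z norm\<omega>
      by (intro sums_sum sums_scaleR_right holomorphic_imp_taylor_sums p(1))
         (simp add: norm_mult norm_power)
    also have "(\<lambda>m. \<Sum>j<n. (1 / real n) *\<^sub>R (c m * (\<omega> ^ j * z) ^ m)) =
                 (\<lambda>m. if n dvd m then c m * z ^ m else 0)"
    proof
      fix m
      have "(\<Sum>j<n. (1 / real n) *\<^sub>R (c m * (\<omega> ^ j * z) ^ m)) =
              (1 / real n) *\<^sub>R (c m * z ^ m * (\<Sum>j<n. (\<omega> ^ j) ^ m))"
        by (simp add: scaleR_right.sum sum_distrib_left power_mult_distrib mult_ac)
      also have "\<dots> = (if n dvd m then c m * z ^ m else 0)"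
        using n sum_root_of_unity_powers[OF n, of m] by (simp add: \<omega>_def scaleR_conv_of_real)
      finally show "(\<Sum>j<n. (1 / real n) *\<^sub>R (c m * (\<omega> ^ j * z) ^ m)) =
              (if n dvd m then c m * z ^ m else 0)" .
    qed
    finally have "(\<lambda>m. if n dvd n * m then c (n * m) * z ^ (n * m) else 0) sums
                    (\<Sum>j<n. (1 / real n) *\<^sub>R p (\<omega> ^ j * z))"
      by (subst sums_mono_reindex[where g = "\<lambda>m. n * m"
            and f = "\<lambda>m. if n dvd m then c m * z ^ m else 0"])
         (use n in \<open>auto simp: strict_mono_def elim!: dvdE\<close>)
    thus ?thesis by (simp add: power_mult)
  qed
  have h: "(\<lambda>m. c (n * m) * w ^ m) sums h w \<and> h w \<in> P ` ball 0 1" if w: "norm w < 1" for w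
  proof -
    obtain z where z: "w = z ^ n"
      using exists_complex_root[of n w] n by auto
    have z1: "norm z < 1"
      using w n power_less_one_iff[of "norm z" n] by (simp add: z norm_power)
    have "h w = (\<Sum>j<n. (1 / real n) *\<^sub>R p (\<omega> ^ j * z))"
      using avg[OF z1] by (simp add: h_def z sums_iff)
    also have "\<dots> \<in> P ` ball 0 1"
    proof (rule convex_sum)
      fix j assume "j \<in> {..<n}"
      have "\<omega> ^ j * z \<in> ball 0 1"
        using z1 norm\<omega> by (simp add: norm_mult norm_power)
      thus "p (\<omega> ^ j * z) \<in> P ` ball 0 1" using p(2) by blast
    qed (use n P(3) in auto)
    finally show ?thesis
      using avg[OF z1] by (auto simp: h_def z sums_iff)
  qed
  have hsums: "\<And>w. norm w < 1 \<Longrightarrow> (\<lambda>m. c (n * m) * w ^ m) sums h w"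
    using h by blast
  have c0: "taylor_coeff g 0 = g 0" "taylor_coeff g 1 = deriv g 0" for g
    by (simp_all add: fps_expansion_def)
  have coeff: "taylor_coeff h m = c (n * m)" for m
    by (rule power_series_on_unit_disc_coeff[OF hsums])
  have "norm (deriv h 0) \<le> norm (deriv P 0)"
  proof (rule subordinate_deriv_le[OF P(1,2)])
    show "h holomorphic_on ball 0 1"
      by (rule power_series_on_unit_disc_holomorphic[OF hsums])
    show "h 0 = P 0"
      using coeff[of 0] p(3) by (simp add: c0 c_def)
  qed (use h in auto)
  also have "deriv h 0 = taylor_coeff p n"
    using coeff[of 1] by (simp add: c0 c_def flip: One_nat_def)
  finally show ?thesis .
qed

section \<open>A majorant for convolution recurrences\<close>

text \<open>
  The bound on \<open>u m\<close> is \<open>P / d m\<close> times a bound on the partial sum of the \<open>norm (u i)\<close>, and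
  adding it to that sum contributes exactly one more factor \<open>1 + P / d m\<close>; so the products
  that appear are the bounds on the partial sums.
\<close>
lemma convolution_recurrence_bound:
  fixes u c :: "nat \<Rightarrow> 'a :: real_normed_field" and d :: "nat \<Rightarrow> real"
  assumes u0: "norm (u 0) = 1"
    and d: "\<And>m. m \<ge> 1 \<Longrightarrow> d m > 0"
    and c: "\<And>i. i \<ge> 1 \<Longrightarrow> norm (c i) \<le> P"
    and rec: "\<And>m. m \<ge> 1 \<Longrightarrow> of_real (d m) * u m = (\<Sum>i=1..m. c i * u (m - i))"
    and m: "m \<ge> 1"
  shows "norm (u m) \<le> P / d m * (\<Prod>j=1..m-1. 1 + P / d j)"
proof -
  have P: "P \<ge> 0"
    using c[of 1] norm_ge_zero[of "c 1"] by linarith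
  have step: "norm (u m) \<le> P / d m * (\<Sum>i<m. norm (u i))" if m: "m \<ge> 1" for m
  proof -
    have "d m * norm (u m) = norm (\<Sum>i=1..m. c i * u (m - i))"
      using d[OF m] arg_cong[OF rec[OF m], of norm] by (simp add: norm_mult)
    also have "\<dots> \<le> (\<Sum>i=1..m. P * norm (u (m - i)))"
      using c by (intro sum_norm_le) (auto simp: norm_mult intro: mult_right_mono)
    also have "\<dots> = P * (\<Sum>i<m. norm (u i))"
      unfolding sum_distrib_left
      by (rule sum.reindex_bij_witness[of _ "\<lambda>i. m - i" "\<lambda>i. m - i"]) auto
    finally show ?thesis
      using d[OF m] by (simp add: field_simps)
  qed
  have partial: "(\<Sum>i<Suc m. norm (u i)) \<le> (\<Prod>j=1..m. 1 + P / d j)" for m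
  proof (induction m)
    case 0
    show ?case by (simp add: u0)
  next
    case (Suc m)
    have "(\<Sum>i<Suc (Suc m). norm (u i)) \<le> (1 + P / d (Suc m)) * (\<Sum>i<Suc m. norm (u i))"
      using step[of "Suc m"] by (simp add: algebra_simps)
    also have "\<dots> \<le> (1 + P / d (Suc m)) * (\<Prod>j=1..m. 1 + P / d j)"
      using P d[of "Suc m"] by (intro mult_left_mono Suc.IH) auto
    finally show ?case by (simp add: mult_ac)
  qed
  have "norm (u m) \<le> P / d m * (\<Sum>i<m. norm (u i))"
    by (rule step[OF m])
  also have "\<dots> \<le> P / d m * (\<Prod>j=1..m-1. 1 + P / d j)"
    using partial[of "m - 1"] P d[OF m] m by (intro mult_left_mono) auto
  finally show ?thesis .
qed

section \<open>Power series of the operator and of its \<open>q\<close>-derivative\<close>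

lemma q_bracket_of_nat:
  assumes "q > 0"
  shows "q_bracket q (real n) = (1 - q ^ n) / (1 - q)"
  using assms by (simp add: q_bracket_def powr_realpow)

lemma q_bracket_pos:
  assumes "0 < q" "q < 1" "x > 0"
  shows "q_bracket q x > 0"
  using q_powr_less_1[OF assms] assms by (simp add: q_bracket_def)

lemma q_bracket_strict_mono:
  assumes "0 < q" "q < 1" "x < y"
  shows "q_bracket q x < q_bracket q y"
  using assms powr_less_mono'[of q x y] by (simp add: q_bracket_def divide_strict_right_mono)

lemma psi_pos:
  assumes "0 < q" "q < 1" "\<alpha> > 0" "\<beta> > -1" "n \<ge> 1"
  shows "psi q \<alpha> \<beta> n > 0"
  unfolding psi_eq_prod[OF assms]
  using assms by (intro prod_pos) (auto intro!: divide_pos_pos q_bracket_pos)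

lemma psi_le_1:
  assumes "0 < q" "q < 1" "\<alpha> > 0" "\<beta> > -1" "n \<ge> 1"
  shows "psi q \<alpha> \<beta> n \<le> 1"
  unfolding psi_eq_prod[OF assms]
proof (rule prod_le_1)
  fix j assume j: "j \<in> {1..n - 1}"
  have "0 < q_bracket q (\<beta> + real j)" "q_bracket q (\<beta> + real j) < q_bracket q (\<alpha> + \<beta> + real j)"
    using assms j by (auto intro!: q_bracket_pos q_bracket_strict_mono)
  thus "0 \<le> q_bracket q (\<beta> + real j) / q_bracket q (\<alpha> + \<beta> + real j) \<and>
        q_bracket q (\<beta> + real j) / q_bracket q (\<alpha> + \<beta> + real j) \<le> 1"
    by simp
qed

text \<open>
  The multipliers \<open>\<psi>\<^sub>n\<close> with \<open>n \<ge> 1\<close> lie in \<open>(0, 1]\<close>, so they do not shrink the disc of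
  convergence. The terms for \<open>n = 0\<close> and \<open>n = 1\<close> are 0 and \<open>z\<close>, whatever \<open>\<psi>\<^sub>0\<close> is, because
  \<open>a\<^sub>0 = 0\<close> and \<open>\<psi>\<^sub>1 = a\<^sub>1 = 1\<close>.
\<close>
lemma chi_sums:
  assumes par: "0 < q" "q < 1" "\<alpha> > 0" "\<beta> > -1" and f: "f \<in> class_A" and z: "norm z < 1"
  shows "(\<lambda>n. of_real (psi q \<alpha> \<beta> n) * taylor_coeff f n * z ^ n) sums chi q \<alpha> \<beta> f z"
proof -
  let ?b = "\<lambda>n. of_real (psi q \<alpha> \<beta> n) * taylor_coeff f n * z ^ n"
  have hol: "f holomorphic_on ball 0 1" and a: "taylor_coeff f 0 = 0" "taylor_coeff f 1 = 1"
    using f by (auto simp: class_A_def fps_expansion_def)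
  \<comment> \<open>Convergence at the larger radius \<open>r\<close> makes the series of \<open>f\<close> at \<open>z\<close> absolutely convergent.\<close>
  obtain r where r: "norm z < r" "r < 1"
    using dense[OF z] by blast
  have r0: "0 < r"
    using r(1) norm_ge_zero[of z] by linarith
  have "summable (\<lambda>n. taylor_coeff f n * of_real r ^ n)"
    using holomorphic_imp_taylor_sums[OF hol, of "of_real r"] r r0 by (simp add: sums_iff)
  hence abs: "summable (\<lambda>n. norm (taylor_coeff f n * z ^ n))"
    by (rule powser_insidea) (use r r0 in simp)
  have "summable ?b"
  proof (rule summable_comparison_test'[OF abs])
    fix n :: nat assume "n \<ge> 1"
    hence "norm (psi q \<alpha> \<beta> n) \<le> 1"
      using psi_pos[OF par, of n] psi_le_1[OF par, of n] by simp
    thus "norm (?b n) \<le> norm (taylor_coeff f n * z ^ n)"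
      by (simp add: norm_mult mult.assoc mult_left_le_one_le)
  qed
  hence "?b sums suminf ?b" "suminf ?b = (\<Sum>n. ?b (n + 2)) + (\<Sum>n<2. ?b n)"
    by (rule summable_sums, rule suminf_split_initial_segment)
  moreover have "psi q \<alpha> \<beta> 1 = 1"
    using psi_eq_prod[OF par, of 1] by simp
  hence "(\<Sum>n<2. ?b n) = z"
    using a by (simp add: numeral_2_eq_2)
  ultimately show ?thesis
    by (simp add: chi_def add.commute)
qed

text \<open>
  Writing \<open>g\<close> for the image of \<open>f\<close> under the operator, the quotient is \<open>D\<^sub>q g / (g / z)\<close>, and
  the series of both factors have explicit coefficients. Cancelling \<open>z\<close> removes the only zero
  of the denominator. Comparing coefficients in \<open>D\<^sub>q g = Q * (g / z)\<close> gives the recurrence,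
  the term \<open>i = 0\<close> of the Cauchy product (where \<open>Q\<close> has coefficient 1) being moved to the left.
\<close>
lemma JUST_quot_holomorphic_recurrence:
  assumes par: "0 < q" "q < 1" "\<alpha> > 0" "\<beta> > -1" and f: "f \<in> class_A"
    and nz: "\<And>z. z \<in> ball 0 1 - {0} \<Longrightarrow> chi q \<alpha> \<beta> f z \<noteq> 0"
  defines "u \<equiv> \<lambda>m. of_real (psi q \<alpha> \<beta> (Suc m)) * taylor_coeff f (Suc m)"
  shows "JUST_quot q \<alpha> \<beta> f holomorphic_on ball 0 1"
    and "of_real (q_bracket q (real m + 1) - 1) * u m =
           (\<Sum>i=1..m. taylor_coeff (JUST_quot q \<alpha> \<beta> f) i * u (m - i))"
proof -
  define g where "g = chi q \<alpha> \<beta> f"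
  define Q where "Q = JUST_quot q \<alpha> \<beta> f"
  \<comment> \<open>The value 1 at 0 is the limit of \<open>g z / z\<close>, because \<open>g'(0) = \<psi>\<^sub>1 a\<^sub>1 = 1\<close>.\<close>
  define U where "U = (\<lambda>z. if z = 0 then 1 else g z / z)"
  define V where "V = (\<lambda>z. Q z * U z)"
  have a: "taylor_coeff f 0 = 0" "taylor_coeff f (Suc 0) = 1"
    using f by (auto simp: class_A_def fps_expansion_def)
  have "psi q \<alpha> \<beta> (Suc 0) = 1"
    using psi_eq_prod[OF par, of 1] by simp
  hence u0: "u 0 = 1"
    by (simp add: u_def a)
  have gsums: "(\<lambda>m. u m * z ^ Suc m) sums g z" if "norm z < 1" for z
    using chi_sums[OF par f that] sums_Suc_iff[of "\<lambda>n. of_real (psi q \<alpha> \<beta> n) * taylor_coeff f n * z ^ n"]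
    by (simp add: a u_def g_def)
  have Usums: "(\<lambda>m. u m * z ^ m) sums U z" if z: "norm z < 1" for z
  proof (cases "z = 0")
    case True
    thus ?thesis using powser_sums_zero[of u] by (simp add: U_def u0)
  next
    case False
    thus ?thesis using sums_divide[OF gsums[OF z], of z] by (simp add: U_def)
  qed
  have Vsums: "(\<lambda>m. (of_real (q_bracket q (real m + 1)) * u m) * z ^ m) sums V z"
    if z: "norm z < 1" for z
  proof (cases "z = 0")
    case True
    have "q_bracket q 1 = 1"
      using par by (simp add: q_bracket_def)
    thus ?thesis using powser_sums_zero[of "\<lambda>m. of_real (q_bracket q (real m + 1)) * u m"]
      by (simp add: V_def U_def Q_def JUST_quot_def u0 True)
  next
    case False
    have qz: "norm (of_real q * z) < 1"
      using z par mult_strict_mono[of q 1 "norm z" 1] by (simp add: norm_mult)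
    have g0: "g z \<noteq> 0"
      using nz[of z] z False by (simp add: g_def)
    have "(\<lambda>m. (u m * z ^ Suc m - u m * (of_real q * z) ^ Suc m) / ((1 - of_real q) * z)) sums
            ((g z - g (of_real q * z)) / ((1 - of_real q) * z))"
      by (intro sums_divide sums_diff gsums z qz)
    moreover have "(u m * z ^ Suc m - u m * (of_real q * z) ^ Suc m) / ((1 - of_real q) * z) =
                     of_real (q_bracket q (real m + 1)) * u m * z ^ m" for m
    proof -
      have br: "of_real (q_bracket q (real m + 1)) = (1 - of_real q ^ Suc m) / (1 - of_real q :: complex)"
        using q_bracket_of_nat[of q "Suc m"] par by (simp add: add.commute)
      have "of_real (1 - q) \<noteq> (0 :: complex)"
        unfolding of_real_eq_0_iff using par by simp
      hence "1 - of_real q \<noteq> (0 :: complex)"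
        by simp
      thus ?thesis
        unfolding br using False by (simp add: divide_simps) (simp add: power_mult_distrib algebra_simps)
    qed
    moreover have "V z = (g z - g (of_real q * z)) / ((1 - of_real q) * z)"
      using False g0 unfolding V_def U_def Q_def JUST_quot_def q_deriv_def
      by (simp add: g_def[symmetric])
    ultimately show ?thesis by simp
  qed
  have U: "U holomorphic_on ball 0 1" "\<And>m. taylor_coeff U m = u m"
    using power_series_on_unit_disc[where a = u, OF Usums] by auto
  have V: "V holomorphic_on ball 0 1"
    "\<And>m. taylor_coeff V m = of_real (q_bracket q (real m + 1)) * u m"
    using power_series_on_unit_disc[OF Vsums] by auto
  have Unz: "U z \<noteq> 0" if "z \<in> ball 0 1" for z
    using nz[of z] that by (auto simp: U_def g_def)
  have "(\<lambda>z. V z / U z) holomorphic_on ball 0 1"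
    by (intro holomorphic_on_divide U V Unz)
  thus hol: "JUST_quot q \<alpha> \<beta> f holomorphic_on ball 0 1"
    by (rule holomorphic_transform) (use Unz in \<open>auto simp: V_def Q_def\<close>)
  have "V has_fps_expansion fps_expansion Q 0 * fps_expansion U 0"
    unfolding V_def using U hol
    by (intro has_fps_expansion_mult has_fps_expansion_fps_expansion[of "ball 0 1"]) (auto simp: Q_def)
  hence "fps_expansion V 0 = fps_expansion Q 0 * fps_expansion U 0"
    by (rule fps_expansion_eqI)
  hence "of_real (q_bracket q (real m + 1)) * u m = (\<Sum>i=0..m. taylor_coeff Q i * u (m - i))"
    by (simp add: fps_mult_nth U(2) flip: V(2))
  also have "\<dots> = u m + (\<Sum>i=1..m. taylor_coeff Q i * u (m - i))"
    by (simp add: sum.atLeast_Suc_atMost fps_expansion_def Q_def JUST_quot_def)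
  finally show "of_real (q_bracket q (real m + 1) - 1) * u m =
           (\<Sum>i=1..m. taylor_coeff (JUST_quot q \<alpha> \<beta> f) i * u (m - i))"
    by (simp add: Q_def algebra_simps)
qed

section \<open>The coefficient bound\<close>

lemma JUST_quot_coeff_bound:
  assumes "0 \<le> \<gamma>" "\<gamma> < 1" "0 < q" "q < 1" "k \<ge> 0" "\<alpha> > 0" "\<beta> > -1"
    and f: "f \<in> JUST k q \<alpha> \<beta> \<gamma>" and "i \<ge> 1"
  shows "norm (taylor_coeff (JUST_quot q \<alpha> \<beta> f) i) \<le> P1 k \<gamma>"
proof -
  note P1 = P1_pos_and_deriv[OF assms(1,2,5)]
  have P: "p_conic k \<gamma> holomorphic_on ball 0 1" "inj_on (p_conic k \<gamma>) (ball 0 1)"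
    "p_conic k \<gamma> ` ball 0 1 = conic_domain k \<gamma>" "p_conic k \<gamma> 0 = 1"
    using p_conic_conformal[OF assms(1,2,5)] by (auto simp: normalised_conformal_map_def)
  have "norm (taylor_coeff (JUST_quot q \<alpha> \<beta> f) i) \<le> norm (deriv (p_conic k \<gamma>) 0)"
  proof (rule convex_subordination_coeff_bound[OF P(1,2)])
    show "JUST_quot q \<alpha> \<beta> f holomorphic_on ball 0 1"
      by (rule JUST_quot_holomorphic_recurrence) (use assms in \<open>auto simp: JUST_def\<close>)
    show "JUST_quot q \<alpha> \<beta> f ` ball 0 1 \<subseteq> p_conic k \<gamma> ` ball 0 1"
      using f by (auto simp: P(3) JUST_def conic_domain_altdef)
    show "JUST_quot q \<alpha> \<beta> f 0 = p_conic k \<gamma> 0"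
      by (simp add: P(4) JUST_quot_def)
  qed (use assms in \<open>auto simp: P(3) convex_conic_domain\<close>)
  thus ?thesis using P1 by simp
qed

theorem theorem2p14:
  fixes f :: "complex \<Rightarrow> complex" and k q \<alpha> \<beta> \<gamma> :: real and n :: nat
  assumes "0 \<le> \<gamma>" and "\<gamma> < 1"
    and "0 < q" and "q < 1"
    and "k \<ge> 0"
    and "\<alpha> > 0" and "\<beta> > -1"
    and "f \<in> JUST k q \<alpha> \<beta> \<gamma>"
    and "n \<ge> 3"
  shows "cmod (taylor_coeff f n) \<le>
    P1 k \<gamma> / ((q_bracket q (real n) - 1) * psi q \<alpha> \<beta> n) *
    (\<Prod>j=1..n-2. 1 + P1 k \<gamma> / (q_bracket q (real j + 1) - 1))"
proof -
  define u where "u = (\<lambda>m. of_real (psi q \<alpha> \<beta> (Suc m)) * taylor_coeff f (Suc m))"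
  define d where "d = (\<lambda>m::nat. q_bracket q (real m + 1) - 1)"
  define m where "m = n - 1"
  have n: "n = Suc m" "m \<ge> 1"
    using assms(9) by (auto simp: m_def)
  have f: "f \<in> class_A" "\<And>z. z \<in> ball 0 1 - {0} \<Longrightarrow> chi q \<alpha> \<beta> f z \<noteq> 0"
    using assms(8) by (auto simp: JUST_def)
  have q1: "q_bracket q 1 = 1"
    using assms by (simp add: q_bracket_def)
  have "norm (u m) \<le> P1 k \<gamma> / d m * (\<Prod>j=1..m-1. 1 + P1 k \<gamma> / d j)"
  proof (rule convolution_recurrence_bound)
    have "taylor_coeff f (Suc 0) = 1"
      using f(1) by (simp add: class_A_def fps_expansion_def)
    thus "norm (u 0) = 1"
      using psi_eq_prod[OF assms(3,4,6,7), of 1] by (simp add: u_def)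
    show "d m > 0" if "m \<ge> 1" for m
      using q_bracket_strict_mono[OF assms(3,4), of 1 "real m + 1"] that by (simp add: d_def q1)
    show "of_real (d m) * u m = (\<Sum>i=1..m. taylor_coeff (JUST_quot q \<alpha> \<beta> f) i * u (m - i))" for m
      unfolding d_def u_def
      by (rule JUST_quot_holomorphic_recurrence(2)[OF assms(3,4,6,7) f])
    show "norm (taylor_coeff (JUST_quot q \<alpha> \<beta> f) i) \<le> P1 k \<gamma>" if "i \<ge> 1" for i
      by (rule JUST_quot_coeff_bound[OF assms(1-8) that])
  qed (rule n(2))
  moreover have psi: "psi q \<alpha> \<beta> n > 0"
    using psi_pos[OF assms(3,4,6,7), of n] n by simp
  ultimately have "norm (taylor_coeff f n) * psi q \<alpha> \<beta> n \<le>
      P1 k \<gamma> / (q_bracket q (real n) - 1) *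
      (\<Prod>j=1..n-2. 1 + P1 k \<gamma> / (q_bracket q (real j + 1) - 1))"
    by (simp add: u_def d_def n(1) norm_mult add.commute mult.commute numeral_2_eq_2)
  hence "norm (taylor_coeff f n) \<le>
      P1 k \<gamma> / (q_bracket q (real n) - 1) *
      (\<Prod>j=1..n-2. 1 + P1 k \<gamma> / (q_bracket q (real j + 1) - 1)) / psi q \<alpha> \<beta> n"
    unfolding pos_le_divide_eq[OF psi] .
  thus ?thesis
    by simp
qed

end
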